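(* Let $f : \mathcal{A}^{\mathbb{Z}} \to \mathcal{A}^{\mathbb{Z}}$ be a one-dimensional cellular automaton over a finite alphabet $\mathcal{A}$. If the generic limit set $\widetilde\omega(f)$ is shift-minimal, then it is inclusion-minimal.
   Context: $\mathcal{A}^{\mathbb{Z}}$ carries the product of the discrete topologies, and $\sigma$ is the left shift, $\sigma(x)_i = x_{i+1}$. A (one-dimensional) cellular automaton is a map $f : \mathcal{A}^{\mathbb{Z}} \to \mathcal{A}^{\mathbb{Z}}$ of the form $f(x)_i = F(x_{i-r},\dots,x_{i+r})$ for some $r \in \mathbb{N}$ and $F : \mathcal{A}^{2r+1} \to \mathcal{A}$. A subshift is a closed $\sigma$-invariant subset of $\mathcal{A}^{\mathbb{Z}}$; it is shift-minimal if it does not properly contain another nonempty subshift. A set is meager if it is a countable union of sets whose closures have empty interior, and comeager if its complement is meager. For $x \in \mathcal{A}^{\mathbb{Z}}$ let $\omega(x) = \bigcap_{N \in \mathbb{N}} \overline{\{f^n(x) \mid n \ge N\}}$, and for a closed set $K$ let $\mathcal{D}(K) = \{x \mid \omega(x) \subset K\}$. $K$ is an attractor if $\mathcal{D}(K)$ is nonmeager and a generic attractor if $\mathcal{D}(K)$ is comeager. The generic limit set $\widetilde\omega(f)$ is the intersection of all generic attractors; it is the smallest generic attractor, and it is a nonempty subshift. An attractor $K$ is inclusion-minimal if $\mathcal{D}(B)$ is meager for every closed set $B \subsetneq K$. *)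

theory Defs
  imports "HOL-Analysis.Analysis"
begin

section \<open>The full shift and cellular automata\<close>

text \<open>
  The alphabet is the (finite) type \<open>'a\<close>. It carries no topology of its own, so the topology on
  configurations is given explicitly instead of through the type-class topology on functions.
\<close>

type_synonym 'a config = "int \<Rightarrow> 'a"

definition full_shift :: "'a config topology" where
  "full_shift = product_topology (\<lambda>_. discrete_topology UNIV) UNIV"

lemma topspace_full_shift [simp]: "topspace full_shift = UNIV"
  by (simp add: full_shift_def)

definition shift :: "'a config \<Rightarrow> 'a config" where
  "shift x = (\<lambda>i. x (i + 1))"

text \<open>The local rule \<open>F\<close> takes a word of length \<open>2 * r + 1\<close>; its values on other lists are irrelevant.\<close>

definition cellular_automaton :: "('a config \<Rightarrow> 'a config) \<Rightarrow> bool" where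
  "cellular_automaton f \<longleftrightarrow>
     (\<exists>(r::nat) (F :: 'a list \<Rightarrow> 'a). \<forall>x i. f x i = F (map x [i - int r..i + int r]))"

text \<open>
  Invariance of a two-sided subshift is invariance under the \<open>\<int>\<close>-action generated by the
  homeomorphism \<open>shift\<close>, hence an equality.
\<close>

definition subshift :: "'a config set \<Rightarrow> bool" where
  "subshift S \<longleftrightarrow> closedin full_shift S \<and> shift ` S = S"

definition shift_minimal :: "'a config set \<Rightarrow> bool" where
  "shift_minimal S \<longleftrightarrow> subshift S \<and> \<not> (\<exists>T. subshift T \<and> T \<noteq> {} \<and> T \<subset> S)"

section \<open>Baire category\<close>

definition nowhere_dense_in :: "'b topology \<Rightarrow> 'b set \<Rightarrow> bool" where
  "nowhere_dense_in X A \<longleftrightarrow> A \<subseteq> topspace X \<and> X interior_of (X closure_of A) = {}"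

definition meager_in :: "'b topology \<Rightarrow> 'b set \<Rightarrow> bool" where
  "meager_in X M \<longleftrightarrow> (\<exists>\<U>. countable \<U> \<and> (\<forall>A\<in>\<U>. nowhere_dense_in X A) \<and> M = \<Union>\<U>)"

definition comeager_in :: "'b topology \<Rightarrow> 'b set \<Rightarrow> bool" where
  "comeager_in X M \<longleftrightarrow> M \<subseteq> topspace X \<and> meager_in X (topspace X - M)"

section \<open>Attractors\<close>

definition omega_limit :: "('a config \<Rightarrow> 'a config) \<Rightarrow> 'a config \<Rightarrow> 'a config set" where
  "omega_limit f x = (\<Inter>N::nat. full_shift closure_of {(f ^^ n) x | n. n \<ge> N})"

definition attraction_domain :: "('a config \<Rightarrow> 'a config) \<Rightarrow> 'a config set \<Rightarrow> 'a config set" where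
  "attraction_domain f K = {x. omega_limit f x \<subseteq> K}"

definition attractor :: "('a config \<Rightarrow> 'a config) \<Rightarrow> 'a config set \<Rightarrow> bool" where
  "attractor f K \<longleftrightarrow> closedin full_shift K \<and> \<not> meager_in full_shift (attraction_domain f K)"

definition generic_attractor :: "('a config \<Rightarrow> 'a config) \<Rightarrow> 'a config set \<Rightarrow> bool" where
  "generic_attractor f K \<longleftrightarrow>
     closedin full_shift K \<and> comeager_in full_shift (attraction_domain f K)"

definition generic_limit_set :: "('a config \<Rightarrow> 'a config) \<Rightarrow> 'a config set" where
  "generic_limit_set f = \<Inter> {K. generic_attractor f K}"

definition inclusion_minimal :: "('a config \<Rightarrow> 'a config) \<Rightarrow> 'a config set \<Rightarrow> bool" where
  "inclusion_minimal f K \<longleftrightarrow>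
     attractor f K \<and>
     (\<forall>B. closedin full_shift B \<and> B \<subset> K \<longrightarrow> meager_in full_shift (attraction_domain f B))"

end

theory Submission
  imports Defs
begin

text \<open>
  Let \<open>W\<close> be the generic limit set. Its attraction domain is comeager, so by the Baire category theorem
  \<open>W\<close> is an attractor. Suppose some closed \<open>B \<subset> W\<close> had a nonmeager domain, and let \<open>U\<close> be a cylinder that
  meets \<open>W\<close> but not \<open>B\<close>. The domain of \<open>B\<close> is covered by the countably many closed sets of points whose
  orbit avoids \<open>U\<close> from time \<open>N\<close> on, so one word \<open>v\<close> and one \<open>N\<close> suffice: every configuration with \<open>v\<close>
  around the origin avoids \<open>U\<close> from time \<open>N\<close> on (\<open>nonmeager_domain_avoiding_cylinder\<close>).

  A cellular automaton commutes with the shift, so a copy of \<open>v\<close> at a position \<open>p\<close> forbids \<open>U\<close> at \<open>p\<close>.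
  Copies of \<open>v\<close> can be placed on any finite set \<open>P\<close> of positions whose distances are at least the length
  of \<open>v\<close>, and a generic configuration with these copies is attracted to \<open>W\<close>. Hence for every such \<open>P\<close> some point
  of \<open>W\<close> avoids \<open>U\<close> at all positions of \<open>P\<close> (\<open>limit_point_avoiding_sparse_positions\<close>).

  A shift-minimal \<open>W\<close> rules this out for a well-chosen \<open>P\<close> (\<open>shift_minimal_unavoidable_positions\<close>).
  One arithmetic progression is not enough, since \<open>W\<close> may have a periodic factor. Fix instead one point
  \<open>y \<in> W\<close>; its set \<open>Q\<close> of visits to \<open>U\<close> has bounded gaps, say it meets all windows of length \<open>M\<close>. Choose
  \<open>s\<close> positions, one in each of \<open>s\<close> windows of length \<open>M\<close> far enough apart that copies of \<open>v\<close> never overlap, and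
  repeat them with period \<open>r\<close> proportional to \<open>s\<close>. If each position is chosen greedily, it brings into
  \<open>Q\<close> at least a fraction \<open>1 / M\<close> of the translates not served before, so at most \<open>r * (1 - 1 / M) ^ s\<close>
  of the \<open>r\<close> translates remain; for large \<open>s\<close> this is less than \<open>1\<close>, so none remains. All translates of this periodic set meet \<open>Q\<close>, as is already
  witnessed on a finite window of \<open>y\<close>, and by minimality that window recurs in every point of \<open>W\<close> within
  a bounded distance of the origin. So every point of \<open>W\<close> visits \<open>U\<close> at one of finitely many positions
  of the periodic set.
\<close>

section \<open>Baire category\<close>

lemma meager_in_subset:
  assumes "meager_in X M" "N \<subseteq> M"
  shows "meager_in X N"
proof -
  obtain \<U> where U: "countable \<U>" "\<forall>A\<in>\<U>. nowhere_dense_in X A" "M = \<Union>\<U>"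
    using assms(1) by (auto simp: meager_in_def)
  have "nowhere_dense_in X (N \<inter> A)" if "A \<in> \<U>" for A
  proof -
    have "nowhere_dense_in X A" using U that by blast
    moreover have "X interior_of (X closure_of (N \<inter> A)) \<subseteq> X interior_of (X closure_of A)"
      by (intro interior_of_mono closure_of_mono) auto
    ultimately show ?thesis by (auto simp: nowhere_dense_in_def)
  qed
  moreover have "N = \<Union> ((\<inter>) N ` \<U>)"
    using U assms(2) by auto
  ultimately show ?thesis
    unfolding meager_in_def using U(1) by (intro exI[of _ "(\<inter>) N ` \<U>"]) auto
qed

lemma meager_in_countable_Union:
  assumes "countable \<M>" "\<And>M. M \<in> \<M> \<Longrightarrow> meager_in X M"
  shows "meager_in X (\<Union>\<M>)"
proof -
  have "\<forall>M\<in>\<M>. \<exists>\<U>. countable \<U> \<and> (\<forall>A\<in>\<U>. nowhere_dense_in X A) \<and> M = \<Union>\<U>"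
    using assms(2) unfolding meager_in_def by blast
  then obtain \<U> where
    U: "\<forall>M\<in>\<M>. countable (\<U> M) \<and> (\<forall>A\<in>\<U> M. nowhere_dense_in X A) \<and> M = \<Union>(\<U> M)"
    by (rule bchoice[THEN exE])
  have "\<Union>\<M> = (\<Union>M\<in>\<M>. \<Union>(\<U> M))"
    using U by (simp cong: SUP_cong)
  also have "\<dots> = \<Union>(\<Union>M\<in>\<M>. \<U> M)" by blast
  finally have "\<Union>\<M> = \<Union>(\<Union>M\<in>\<M>. \<U> M)" .
  moreover have "countable (\<Union>M\<in>\<M>. \<U> M)"
    using U assms(1) by (intro countable_UN) auto
  moreover have "\<forall>A\<in>(\<Union>M\<in>\<M>. \<U> M). nowhere_dense_in X A"
    using U by blast
  ultimately show ?thesis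
    unfolding meager_in_def by (intro exI conjI)
qed

lemma meager_in_Union_closed:
  assumes "countable \<C>" "\<And>C. C \<in> \<C> \<Longrightarrow> closedin X C \<and> X interior_of C = {}"
  shows "meager_in X (\<Union>\<C>)"
  unfolding meager_in_def nowhere_dense_in_def
  using assms by (intro exI[of _ \<C>]) (auto simp: closure_of_closedin dest: closedin_subset)

lemma meager_in_interior_empty:
  assumes "compact_space X" "Hausdorff_space X" "meager_in X M"
  shows "X interior_of M = {}"
proof -
  obtain \<U> where U: "countable \<U>" "\<forall>A\<in>\<U>. nowhere_dense_in X A" "M = \<Union>\<U>"
    using assms(3) by (auto simp: meager_in_def)
  have "X interior_of \<Union> ((closure_of) X ` \<U>) = {}"
  proof (rule Baire_category_alt)
    show "completely_metrizable_space X \<or> locally_compact_space X \<and> regular_space X"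
      using assms compact_Hausdorff_imp_regular_space compact_imp_locally_compact_space by blast
  qed (use U in \<open>auto simp: nowhere_dense_in_def\<close>)
  moreover have "M \<subseteq> \<Union> ((closure_of) X ` \<U>)"
    using U by (fastforce simp: nowhere_dense_in_def dest: closure_of_subset)
  ultimately show ?thesis
    using interior_of_mono by blast
qed

section \<open>Cylinders and compactness\<close>

definition cylinder :: "nat \<Rightarrow> 'a config \<Rightarrow> 'a config set" where
  "cylinder m x = {y. \<forall>i. \<bar>i\<bar> \<le> int m \<longrightarrow> y i = x i}"

lemma self_in_cylinder [simp]: "x \<in> cylinder m x"
  by (simp add: cylinder_def)

lemma openin_full_shift_iff:
  "openin full_shift S \<longleftrightarrow> (\<forall>x\<in>S. \<exists>m. cylinder m x \<subseteq> S)"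
proof
  assume L: "openin full_shift S"
  show "\<forall>x\<in>S. \<exists>m. cylinder m x \<subseteq> S"
  proof
    fix x assume "x \<in> S"
    then obtain U where U: "finite {i. U i \<noteq> UNIV}" "x \<in> Pi\<^sub>E UNIV U" "Pi\<^sub>E UNIV U \<subseteq> S"
      using L unfolding full_shift_def openin_product_topology_alt by force
    define m where "m = nat (\<Sum>i\<in>{i. U i \<noteq> UNIV}. \<bar>i\<bar>)"
    have m: "\<bar>i\<bar> \<le> int m" if "U i \<noteq> UNIV" for i
    proof -
      have "\<bar>i\<bar> \<le> (\<Sum>i\<in>{i. U i \<noteq> UNIV}. \<bar>i\<bar>)"
        using that U(1) by (intro member_le_sum) auto
      then show ?thesis by (simp add: m_def)
    qed
    have "y \<in> Pi\<^sub>E UNIV U" if "y \<in> cylinder m x" for y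
    proof (rule PiE_I)
      fix i show "y i \<in> U i"
        using m[of i] that U(2) by (cases "U i = UNIV") (auto simp: cylinder_def PiE_iff)
    qed simp
    then show "\<exists>m. cylinder m x \<subseteq> S" using U(3) by blast
  qed
next
  assume R: "\<forall>x\<in>S. \<exists>m. cylinder m x \<subseteq> S"
  show "openin full_shift S"
    unfolding full_shift_def openin_product_topology_alt
  proof
    fix x assume "x \<in> S"
    then obtain m where m: "cylinder m x \<subseteq> S" using R by blast
    define U where "U i = (if \<bar>i\<bar> \<le> int m then {x i} else UNIV)" for i
    have "{i. U i \<noteq> UNIV} \<subseteq> {- int m..int m}"
      by (auto simp: U_def split: if_splits)
    then have "finite {i. U i \<noteq> UNIV}" by (rule finite_subset) simp
    moreover have "x \<in> Pi\<^sub>E UNIV U" by (simp add: U_def PiE_iff)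
    moreover have "Pi\<^sub>E UNIV U \<subseteq> S"
      using m by (force simp: U_def PiE_iff cylinder_def split: if_splits)
    ultimately show "\<exists>U. finite {i \<in> UNIV. U i \<noteq> topspace (discrete_topology UNIV)} \<and>
        (\<forall>i\<in>UNIV. openin (discrete_topology UNIV) (U i)) \<and> x \<in> Pi\<^sub>E UNIV U \<and> Pi\<^sub>E UNIV U \<subseteq> S"
      by (intro exI[of _ U]) auto
  qed
qed

lemma closedin_full_shift_iff: "closedin full_shift S \<longleftrightarrow> openin full_shift (- S)"
  by (simp add: closedin_def Compl_eq_Diff_UNIV)

lemma openin_full_shift_UNIV: "openin full_shift UNIV"
  by (simp add: openin_full_shift_iff)

lemma closedin_full_shift_UNIV: "closedin full_shift UNIV"
  by (simp add: closedin_full_shift_iff)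

lemma openin_cylinder: "openin full_shift (cylinder m x)"
  by (force simp: openin_full_shift_iff cylinder_def)

lemma closedin_cylinder: "closedin full_shift (cylinder m x)"
proof -
  have "\<exists>n. cylinder n y \<subseteq> - cylinder m x" if "y \<notin> cylinder m x" for y
    using that by (intro exI[of _ m]) (force simp: cylinder_def)
  then show ?thesis
    by (simp add: closedin_full_shift_iff openin_full_shift_iff)
qed

lemma countable_cylinders: "countable {C :: 'a::finite config set. \<exists>m x. C = cylinder m x}"
proof -
  define word_set where "word_set = (\<lambda>(m, w). {y :: 'a config. map y [- int m..int m] = w})"
  have "cylinder m x = word_set (m, map x [- int m..int m])" for m and x :: "'a config"
    by (auto simp: cylinder_def word_set_def abs_le_iff)
  then have "{C :: 'a config set. \<exists>m x. C = cylinder m x} \<subseteq> range word_set"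
    by (intro subsetI, elim CollectE exE) (simp only: rangeI)
  then show ?thesis
    by (rule countable_subset) simp
qed

lemma compact_full_shift: "compact_space (full_shift :: 'a::finite config topology)"
  by (simp add: full_shift_def compact_space_product_topology compact_space_discrete_topology)

lemma Hausdorff_full_shift: "Hausdorff_space full_shift"
  by (simp add: full_shift_def Hausdorff_space_product_topology)

lemma comeager_meets_open:
  fixes G :: "'a::finite config set"
  assumes "comeager_in full_shift D" "openin full_shift G" "G \<noteq> {}"
  shows "G \<inter> D \<noteq> {}"
proof
  assume "G \<inter> D = {}"
  then have "G \<subseteq> full_shift interior_of (topspace full_shift - D)"
    using assms(2) by (intro interior_of_maximal) auto
  moreover have "full_shift interior_of (topspace full_shift - D) = {}"
    using assms(1) compact_full_shift Hausdorff_full_shift meager_in_interior_empty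
    unfolding comeager_in_def by blast
  ultimately show False using assms(3) by simp
qed

section \<open>Omega limits\<close>

lemma omega_limit_visits:
  assumes "z \<in> omega_limit f x" "openin full_shift U" "z \<in> U"
  shows "\<exists>n\<ge>N. (f ^^ n) x \<in> U"
proof -
  have "z \<in> full_shift closure_of {(f ^^ n) x | n. n \<ge> N}"
    using assms(1) by (auto simp: omega_limit_def)
  then show ?thesis
    using assms(2,3) by (auto simp: in_closure_of)
qed

text \<open>Compactness turns infinitely many visits to a closed set into a limit point inside it; with
  \<open>C = UNIV\<close> this says that \<open>\<omega>(x)\<close> is nonempty.\<close>

lemma omega_limit_meets:
  fixes f :: "'a::finite config \<Rightarrow> 'a config"
  assumes "closedin full_shift C" "\<And>N. \<exists>n\<ge>N. (f ^^ n) x \<in> C"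
  shows "omega_limit f x \<inter> C \<noteq> {}"
proof -
  define A where "A N = {(f ^^ n) x | n. n \<ge> N \<and> (f ^^ n) x \<in> C}" for N :: nat
  have "(\<Inter>N. full_shift closure_of A N) \<noteq> {}"
  proof (rule compact_space_imp_nest[OF compact_full_shift])
    show "decseq (\<lambda>N. full_shift closure_of A N)"
      by (intro decseq_SucI closure_of_mono) (auto simp: A_def)
    show "full_shift closure_of A N \<noteq> {}" for N
      using assms(2)[of N] by (auto simp: closure_of_eq_empty A_def)
  qed simp
  then obtain z where z: "\<And>N. z \<in> full_shift closure_of A N" by blast
  have "full_shift closure_of A 0 \<subseteq> C"
    by (intro closure_of_minimal assms(1)) (auto simp: A_def)
  moreover have "full_shift closure_of A N \<subseteq> full_shift closure_of {(f ^^ n) x | n. n \<ge> N}" for N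
    by (intro closure_of_mono) (auto simp: A_def)
  ultimately have "z \<in> C" "z \<in> omega_limit f x"
    using z unfolding omega_limit_def by blast+
  then show ?thesis by blast
qed

text \<open>The generic limit set is a possibly uncountable intersection, but a countable base reduces it
  to countably many generic attractors: every limit point outside it lies in one of countably many
  cylinders, each disjoint from some generic attractor.\<close>

lemma generic_limit_set_generic_attractor:
  fixes f :: "'a::finite config \<Rightarrow> 'a config"
  shows "generic_attractor f (generic_limit_set f)"
proof -
  define W where "W = generic_limit_set f"
  define \<C> where "\<C> = {C. (\<exists>m x. C = cylinder m x) \<and> (\<exists>K. generic_attractor f K \<and> C \<inter> K = {})}"
  define E where "E C = {x. omega_limit f x \<inter> C \<noteq> {}}" for C
  have outside: "\<exists>C\<in>\<C>. y \<in> C" if y: "y \<notin> W" for y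
  proof -
    obtain K where K: "generic_attractor f K" "y \<notin> K"
      using y by (auto simp: W_def generic_limit_set_def)
    then have "openin full_shift (- K)"
      by (simp add: generic_attractor_def closedin_full_shift_iff)
    then obtain m where "cylinder m y \<subseteq> - K"
      using K by (auto simp: openin_full_shift_iff)
    then have "cylinder m y \<in> \<C>" using K by (auto simp: \<C>_def)
    then show ?thesis by (rule bexI[rotated]) (rule self_in_cylinder)
  qed
  have "meager_in full_shift (\<Union>(E ` \<C>))"
  proof (rule meager_in_countable_Union)
    show "countable (E ` \<C>)"
      by (intro countable_image countable_subset[OF _ countable_cylinders]) (auto simp: \<C>_def)
    fix M assume "M \<in> E ` \<C>"
    then obtain C K where CK: "M = E C" "generic_attractor f K" "C \<inter> K = {}"
      by (auto simp: \<C>_def)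
    have "E C \<subseteq> UNIV - attraction_domain f K"
      using CK(3) by (auto simp: E_def attraction_domain_def)
    moreover have "meager_in full_shift (UNIV - attraction_domain f K)"
      using CK(2) by (simp add: generic_attractor_def comeager_in_def)
    ultimately show "meager_in full_shift M"
      unfolding CK(1) by (rule meager_in_subset[rotated])
  qed
  moreover have "UNIV - attraction_domain f W \<subseteq> \<Union>(E ` \<C>)"
  proof
    fix x assume "x \<in> UNIV - attraction_domain f W"
    then obtain y where y: "y \<in> omega_limit f x" "y \<notin> W"
      by (auto simp: attraction_domain_def)
    from outside[OF y(2)] obtain C where "C \<in> \<C>" "y \<in> C" ..
    then show "x \<in> \<Union>(E ` \<C>)"
      using y(1) by (auto simp: E_def)
  qed
  ultimately have "meager_in full_shift (UNIV - attraction_domain f W)"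
    by (rule meager_in_subset)
  moreover have "closedin full_shift W"
  proof -
    have "closedin full_shift (\<Inter>(insert UNIV {K. generic_attractor f K}))"
      by (intro closedin_Inter) (auto simp: generic_attractor_def closedin_full_shift_UNIV)
    then show ?thesis by (simp add: W_def generic_limit_set_def)
  qed
  ultimately show ?thesis
    unfolding generic_attractor_def comeager_in_def W_def topspace_full_shift by blast
qed

section \<open>Translations\<close>

definition translate :: "int \<Rightarrow> 'a config \<Rightarrow> 'a config" where
  "translate j x = (\<lambda>i. x (i + j))"

lemma translate_translate [simp]: "translate i (translate j x) = translate (i + j) x"
  by (simp add: translate_def ac_simps)

lemma translate_0 [simp]: "translate 0 x = x"
  by (simp add: translate_def)

lemma shift_eq_translate: "shift = translate 1"
  by (auto simp: shift_def translate_def)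

lemma openin_translate_vimage:
  assumes "openin full_shift U"
  shows "openin full_shift (translate j -` U)"
  unfolding openin_full_shift_iff
proof
  fix x assume "x \<in> translate j -` U"
  then obtain m where m: "cylinder m (translate j x) \<subseteq> U"
    using assms by (auto simp: openin_full_shift_iff)
  have "cylinder (m + nat \<bar>j\<bar>) x \<subseteq> translate j -` U"
  proof
    fix y assume y: "y \<in> cylinder (m + nat \<bar>j\<bar>) x"
    have "translate j y \<in> cylinder m (translate j x)"
      using y by (auto simp: cylinder_def translate_def)
    then show "y \<in> translate j -` U" using m by auto
  qed
  then show "\<exists>m. cylinder m x \<subseteq> translate j -` U" ..
qed

lemma translate_subshift:
  assumes "subshift S" "x \<in> S"
  shows "translate j x \<in> S"
proof -
  have S: "translate 1 ` S = S"
    using assms(1) by (simp add: subshift_def shift_eq_translate)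
  have down: "translate (- 1) y \<in> S" if y: "y \<in> S" for y
  proof -
    obtain z where "z \<in> S" "y = translate 1 z" using S y by (metis imageE)
    then show ?thesis by simp
  qed
  show ?thesis
  proof (induction j rule: int_induct[where k = 0])
    case base then show ?case using assms by simp
  next
    case (step1 i)
    then have "translate 1 (translate i x) \<in> S" using S by (metis imageI)
    then show ?case by (simp add: add.commute)
  next
    case (step2 i)
    then have "translate (- 1) (translate i x) \<in> S" by (intro down)
    then show ?case by (simp add: algebra_simps)
  qed
qed

lemma subshiftI:
  assumes "closedin full_shift S" "\<And>x j. x \<in> S \<Longrightarrow> translate j x \<in> S"
  shows "subshift S"
proof -
  have "x \<in> translate 1 ` S" if "x \<in> S" for x
    using assms(2)[OF that, of "-1"] by (intro rev_image_eqI[of "translate (- 1) x"]) auto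
  then show ?thesis
    using assms by (auto simp: subshift_def shift_eq_translate)
qed

text \<open>Uniform recurrence: the points of \<open>W\<close> whose orbit misses \<open>V\<close> form a proper subshift, which is
  empty by minimality; compactness makes the return time uniform.\<close>

lemma shift_minimal_returns:
  fixes W :: "'a::finite config set"
  assumes "shift_minimal W" "openin full_shift V" "W \<inter> V \<noteq> {}"
  obtains L :: nat where "\<And>z. z \<in> W \<Longrightarrow> \<exists>j. \<bar>j\<bar> \<le> int L \<and> translate j z \<in> V"
proof -
  have W: "subshift W" "closedin full_shift W"
    using assms(1) by (auto simp: shift_minimal_def subshift_def)
  define A where "A L = W \<inter> (\<Inter>j\<in>{- int L..int L}. - (translate j -` V))" for L :: nat
  have clA: "closedin full_shift (A L)" for L
    unfolding A_def
    by (intro closedin_Int closedin_INT W)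
       (auto simp: closedin_full_shift_iff openin_translate_vimage assms(2))
  have "\<exists>L. A L = {}"
  proof (rule ccontr)
    assume ne: "\<not> (\<exists>L. A L = {})"
    have ne': "(\<Inter>L. A L) \<noteq> {}"
      by (rule compact_space_imp_nest[OF compact_full_shift])
         (use clA ne in \<open>auto simp: A_def intro!: decseq_SucI\<close>)
    have T: "(\<Inter>L. A L) = {z \<in> W. \<forall>j. translate j z \<notin> V}"
    proof -
      have "translate j z \<notin> V" if "\<forall>L. z \<in> A L" for j z
        using that[rule_format, of "nat \<bar>j\<bar>"] abs_ge_self[of j] abs_ge_minus_self[of j]
        unfolding A_def by force
      then show ?thesis by (auto simp: A_def)
    qed
    have "subshift (\<Inter>L. A L)"
    proof (rule subshiftI)
      show "closedin full_shift (\<Inter>L. A L)" using clA by blast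
      show "translate j x \<in> (\<Inter>L. A L)" if "x \<in> (\<Inter>L. A L)" for x j
        using that unfolding T by (auto intro: translate_subshift[OF W(1)])
    qed
    moreover have "(\<Inter>L. A L) \<subset> W"
    proof -
      obtain y where "y \<in> W" "translate 0 y \<in> V" using assms(3) by auto
      then show ?thesis unfolding T by blast
    qed
    ultimately show False
      using ne' assms(1) by (auto simp: shift_minimal_def)
  qed
  then obtain L where "A L = {}" ..
  then have "\<exists>j. \<bar>j\<bar> \<le> int L \<and> translate j z \<in> V" if "z \<in> W" for z
    using that by (force simp: A_def)
  then show ?thesis by (rule that)
qed

section \<open>Cellular automata\<close>

lemma cellular_automaton_translate:
  assumes "cellular_automaton f"
  shows "f (translate j x) = translate j (f x)"
proof -
  obtain r F where F: "\<And>x i. f x i = F (map x [i - int r..i + int r])"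
    using assms by (auto simp: cellular_automaton_def)
  have "map (translate j x) [i - int r..i + int r] = map x [i + j - int r..i + j + int r]" for i
    by (rule nth_equalityI) (auto simp: translate_def algebra_simps)
  then show ?thesis
    by (intro ext) (simp add: F translate_def)
qed

lemma cellular_automaton_funpow_translate:
  assumes "cellular_automaton f"
  shows "(f ^^ n) (translate j x) = translate j ((f ^^ n) x)"
  by (induction n) (simp_all add: cellular_automaton_translate[OF assms])

lemma cellular_automaton_open_vimage:
  assumes "cellular_automaton f" "openin full_shift U"
  shows "openin full_shift ((f ^^ n) -` U)"
proof (induction n)
  case 0 then show ?case using assms(2) by simp
next
  case (Suc n)
  obtain r F where F: "\<And>x i. f x i = F (map x [i - int r..i + int r])"
    using assms(1) by (auto simp: cellular_automaton_def)
  have "openin full_shift (f -` V)" if V: "openin full_shift V" for V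
    unfolding openin_full_shift_iff
  proof
    fix x assume "x \<in> f -` V"
    then obtain m where m: "cylinder m (f x) \<subseteq> V"
      using V by (auto simp: openin_full_shift_iff)
    have "f y \<in> cylinder m (f x)" if "y \<in> cylinder (m + r) x" for y
    proof -
      have "map y [i - int r..i + int r] = map x [i - int r..i + int r]" if "\<bar>i\<bar> \<le> int m" for i
        using \<open>y \<in> cylinder (m + r) x\<close> that by (auto simp: cylinder_def)
      then show ?thesis by (simp add: cylinder_def F del: map_eq_conv)
    qed
    then show "\<exists>m. cylinder m x \<subseteq> f -` V" using m by (intro exI[of _ "m + r"]) auto
  qed
  from this[OF Suc] show ?case
    by (simp add: vimage_def funpow_Suc_right del: funpow.simps)
qed

section \<open>Sparse sets of positions that cannot avoid a syndetic set\<close>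

text \<open>Averaging: each \<open>t \<in> T\<close> is good for at least one of the \<open>M\<close> candidates \<open>p\<close>, so some candidate
  is good for a fraction \<open>1 / M\<close> of \<open>T\<close>.\<close>

lemma averaging_step:
  fixes T Q :: "int set" and M :: nat
  assumes "finite T" and Q: "\<And>a. \<exists>j\<in>{a..<a + int M}. j \<in> Q"
  shows "\<exists>p\<in>{a..<a + int M}. card {t\<in>T. p + t \<notin> Q} * M \<le> card T * (M - 1)"
proof -
  have "\<exists>p\<in>{a..<a + int M}. card T \<le> card {t\<in>T. p + t \<in> Q} * M"
  proof (rule ccontr)
    assume neg: "\<not> ?thesis"
    have "M > 0" using Q[of 0] by auto
    have eq: "T = (\<Union>p\<in>{a..<a + int M}. {t\<in>T. p + t \<in> Q})"
    proof -
      have "\<exists>p\<in>{a..<a + int M}. p + t \<in> Q" for t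
      proof -
        obtain j where "j \<in> {a + t..<a + t + int M}" "j \<in> Q" using Q by blast
        then show ?thesis by (intro bexI[of _ "j - t"]) auto
      qed
      then show ?thesis by blast
    qed
    have "card T = card (\<Union>p\<in>{a..<a + int M}. {t\<in>T. p + t \<in> Q})"
      by (rule arg_cong[OF eq])
    also have "\<dots> \<le> (\<Sum>p\<in>{a..<a + int M}. card {t\<in>T. p + t \<in> Q})"
      by (rule card_UN_le) simp
    finally have "card T \<le> (\<Sum>p\<in>{a..<a + int M}. card {t\<in>T. p + t \<in> Q})" .
    then have "card T * M \<le> (\<Sum>p\<in>{a..<a + int M}. card {t\<in>T. p + t \<in> Q} * M)"
      by (simp flip: sum_distrib_right)
    also have "\<dots> < (\<Sum>p\<in>{a..<a + int M}. card T)"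
      using neg \<open>M > 0\<close> by (intro sum_strict_mono) (auto simp: not_le)
    finally show False by simp
  qed
  then obtain p where p: "p \<in> {a..<a + int M}" "card T \<le> card {t\<in>T. p + t \<in> Q} * M" by blast
  define a' where "a' = card {t\<in>T. p + t \<in> Q}"
  define b' where "b' = card {t\<in>T. p + t \<notin> Q}"
  have "card ({t\<in>T. p + t \<in> Q} \<union> {t\<in>T. p + t \<notin> Q}) = a' + b'"
    unfolding a'_def b'_def using assms(1) by (intro card_Un_disjoint) auto
  moreover have "{t\<in>T. p + t \<in> Q} \<union> {t\<in>T. p + t \<notin> Q} = T" by blast
  ultimately have T: "card T = a' + b'" by simp
  have "M > 0" using p(1) by auto
  then obtain K where K: "M = Suc K" using gr0_implies_Suc by blast
  have "a' + b' \<le> a' * M" using p(2) unfolding T a'_def[symmetric] .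
  then have "b' * M \<le> (a' + b') * (M - 1)" by (simp add: K algebra_simps)
  then have "card {t\<in>T. p + t \<notin> Q} * M \<le> card T * (M - 1)" unfolding T b'_def .
  then show ?thesis using p(1) by blast
qed

lemma greedy_positions:
  fixes T Q :: "int set" and M c s :: nat
  assumes "finite T" and Q: "\<And>a. \<exists>j\<in>{a..<a + int M}. j \<in> Q"
  shows "\<exists>p. (\<forall>i<s. p i \<in> {int (i * c)..<int (i * c) + int M}) \<and>
    card {t\<in>T. \<forall>i<s. p i + t \<notin> Q} * M ^ s \<le> card T * (M - 1) ^ s"
proof (induction s)
  case 0 then show ?case by simp
next
  case (Suc s)
  then obtain p where p: "\<forall>i<s. p i \<in> {int (i * c)..<int (i * c) + int M}"
    "card {t\<in>T. \<forall>i<s. p i + t \<notin> Q} * M ^ s \<le> card T * (M - 1) ^ s" by blast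
  define T' where "T' = {t\<in>T. \<forall>i<s. p i + t \<notin> Q}"
  have "finite T'" using assms(1) by (simp add: T'_def)
  from averaging_step[OF this Q] obtain q where
    q: "q \<in> {int (s * c)..<int (s * c) + int M}" "card {t\<in>T'. q + t \<notin> Q} * M \<le> card T' * (M - 1)"
    by blast
  have eq: "{t\<in>T. \<forall>i<Suc s. (p(s := q)) i + t \<notin> Q} = {t\<in>T'. q + t \<notin> Q}"
    by (auto simp: T'_def less_Suc_eq)
  have "card {t\<in>T'. q + t \<notin> Q} * M ^ Suc s \<le> card T' * (M - 1) * M ^ s"
    using mult_le_mono1[OF q(2), of "M ^ s"] by (simp add: ac_simps)
  also have "\<dots> = card T' * M ^ s * (M - 1)" by simp
  also have "\<dots> \<le> card T * (M - 1) ^ s * (M - 1)"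
    using p(2) by (intro mult_le_mono1) (simp add: T'_def)
  finally have "card {t\<in>T. \<forall>i<Suc s. (p(s := q)) i + t \<notin> Q} * M ^ Suc s \<le> card T * (M - 1) ^ Suc s"
    unfolding eq by (simp add: ac_simps)
  moreover have "\<forall>i<Suc s. (p(s := q)) i \<in> {int (i * c)..<int (i * c) + int M}"
    using p(1) q(1) by (auto simp: less_Suc_eq)
  ultimately show ?case by blast
qed

text \<open>The number of translates still uncovered decays exponentially in \<open>s\<close>, whereas the period
  \<open>s * c\<close>, which is the number of translates to cover, grows only linearly.\<close>

lemma periodic_positions_meeting_syndetic:
  fixes Q :: "int set" and M c :: nat
  assumes "c > 0" and Q: "\<And>a. \<exists>j\<in>{a..<a + int M}. j \<in> Q"
  obtains s :: nat and p where "s > 0" "\<And>i. i < s \<Longrightarrow> p i \<in> {int (i * c)..<int (i * c) + int M}"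
    "\<And>t. 0 \<le> t \<Longrightarrow> t < int (s * c) \<Longrightarrow> \<exists>i<s. p i + t \<in> Q"
proof -
  have M: "M > 0" using Q[of 0] by auto
  define \<theta> where "\<theta> = real (M - 1) / real M"
  have "norm \<theta> < 1" using M by (simp add: \<theta>_def)
  then have "(\<lambda>s. real c * (real s * \<theta> ^ s)) \<longlonglongrightarrow> real c * 0"
    by (intro tendsto_mult_left powser_times_n_limit_0)
  then have "eventually (\<lambda>s. real c * (real s * \<theta> ^ s) < 1) sequentially"
    by (intro order_tendstoD(2)) auto
  then have "eventually (\<lambda>s. real c * (real s * \<theta> ^ s) < 1 \<and> s > 0) sequentially"
    using eventually_gt_at_top[of 0] by eventually_elim simp
  from eventually_happens'[OF sequentially_bot this]
  obtain s where s: "real c * (real s * \<theta> ^ s) < 1" "s > 0" by blast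
  have "real (s * c * (M - 1) ^ s) = (real c * (real s * \<theta> ^ s)) * real (M ^ s)"
    using M by (simp add: \<theta>_def power_divide)
  also have "\<dots> < 1 * real (M ^ s)"
    using s(1) M by (intro mult_strict_right_mono) auto
  finally have "real (s * c * (M - 1) ^ s) < real (M ^ s)" by simp
  then have small: "s * c * (M - 1) ^ s < M ^ s"
    by (simp only: of_nat_less_iff)
  have "\<exists>p. (\<forall>i<s. p i \<in> {int (i * c)..<int (i * c) + int M}) \<and>
      card {t\<in>{0..<int (s * c)}. \<forall>i<s. p i + t \<notin> Q} * M ^ s \<le> card {0..<int (s * c)} * (M - 1) ^ s"
    by (rule greedy_positions[OF finite_atLeastLessThan_int Q])
  then obtain p where p: "\<forall>i<s. p i \<in> {int (i * c)..<int (i * c) + int M}"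
    and p_card: "card {t\<in>{0..<int (s * c)}. \<forall>i<s. p i + t \<notin> Q} * M ^ s
      \<le> card {0..<int (s * c)} * (M - 1) ^ s"
    by (elim exE conjE)
  define R where "R = {t\<in>{0..<int (s * c)}. \<forall>i<s. p i + t \<notin> Q}"
  have "card {0..<int (s * c)} = s * c"
    by (simp only: card_atLeastLessThan_int diff_zero nat_int)
  then have "card R * M ^ s \<le> s * c * (M - 1) ^ s"
    using p_card by (simp only: R_def)
  then have "card R * M ^ s < 1 * M ^ s"
    using small by linarith
  then have "card R = 0"
    unfolding mult_less_cancel2 by simp
  moreover have "finite R"
    unfolding R_def by (rule finite_subset[of _ "{0..<int (s * c)}"]) auto
  ultimately have "R = {}" by simp
  then have "\<exists>i<s. p i + t \<in> Q" if "0 \<le> t" "t < int (s * c)" for t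
    using that unfolding R_def by force
  with s(2) p[rule_format] show ?thesis by (rule that)
qed

section \<open>Minimality of the generic limit set\<close>

text \<open>The points \<open>x\<close> whose orbit avoids \<open>U\<close> from time \<open>N\<close> on form closed sets that cover the domain of
  \<open>B\<close>, so by the definition of meagerness one of them contains a cylinder.\<close>

lemma nonmeager_domain_avoiding_cylinder:
  fixes f :: "'a::finite config \<Rightarrow> 'a config"
  assumes f: "cellular_automaton f"
    and nonmeager: "\<not> meager_in full_shift (attraction_domain f B)"
    and U: "openin full_shift U" "closedin full_shift U" "U \<inter> B = {}"
  obtains m v N where "\<And>x n. x \<in> cylinder m v \<Longrightarrow> n \<ge> N \<Longrightarrow> (f ^^ n) x \<notin> U"
proof -
  define E where "E N = (\<Inter>n\<in>{N..}. - ((f ^^ n) -` U))" for N :: nat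
  have closed: "closedin full_shift (E N)" for N
    unfolding E_def
    by (intro closedin_INT) (auto simp: closedin_full_shift_iff cellular_automaton_open_vimage f U(1))
  have "attraction_domain f B \<subseteq> \<Union>(range E)"
  proof
    fix x assume x: "x \<in> attraction_domain f B"
    then have "omega_limit f x \<inter> U = {}"
      using U(3) by (auto simp: attraction_domain_def)
    then have "\<not> (\<forall>N. \<exists>n\<ge>N. (f ^^ n) x \<in> U)"
      using omega_limit_meets[OF U(2), of f x] by metis
    then show "x \<in> \<Union>(range E)" by (auto simp: E_def)
  qed
  then have "\<not> meager_in full_shift (\<Union>(range E))"
    using nonmeager by (metis meager_in_subset)
  then have "\<not> (\<forall>C\<in>range E. closedin full_shift C \<and> full_shift interior_of C = {})"
    using meager_in_Union_closed[of "range E" full_shift] by (metis countableI_type countable_image)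
  then obtain N where "full_shift interior_of (E N) \<noteq> {}"
    using closed by blast
  then obtain v where v: "v \<in> full_shift interior_of (E N)" by blast
  moreover have "\<forall>x\<in>full_shift interior_of (E N). \<exists>m. cylinder m x \<subseteq> full_shift interior_of (E N)"
    by (simp only: openin_interior_of flip: openin_full_shift_iff)
  ultimately obtain m where "cylinder m v \<subseteq> full_shift interior_of (E N)" by metis
  then have "cylinder m v \<subseteq> E N"
    using interior_of_subset[of full_shift "E N"] by (rule subset_trans)
  then have "\<And>x n. x \<in> cylinder m v \<Longrightarrow> n \<ge> N \<Longrightarrow> (f ^^ n) x \<notin> U"
    by (auto simp: E_def)
  then show ?thesis by (rule that)
qed

lemma cylinder_copies_at_sparse_positions:
  assumes sparse: "\<And>p q. p \<in> P \<Longrightarrow> q \<in> P \<Longrightarrow> p \<noteq> q \<Longrightarrow> \<bar>p - q\<bar> > 2 * int m"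
  shows "\<exists>x. \<forall>p\<in>P. translate p x \<in> cylinder m v"
proof -
  define x where "x i = v (i - (THE p. p \<in> P \<and> \<bar>i - p\<bar> \<le> int m))" for i
  have "translate p x \<in> cylinder m v" if p: "p \<in> P" for p
  proof -
    have "(THE q. q \<in> P \<and> \<bar>i + p - q\<bar> \<le> int m) = p" if i: "\<bar>i\<bar> \<le> int m" for i
    proof (rule the_equality)
      show "p \<in> P \<and> \<bar>i + p - p\<bar> \<le> int m" using p i by simp
      show "q = p" if "q \<in> P \<and> \<bar>i + p - q\<bar> \<le> int m" for q
        using sparse[of p q] p i that by linarith
    qed
    then show ?thesis by (simp add: cylinder_def translate_def x_def)
  qed
  then show ?thesis by blast
qed

text \<open>Since \<open>f\<close> commutes with translations, a copy of the word \<open>v\<close> at position \<open>p\<close> keeps the orbit out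
  of \<open>translate p -` U\<close> from time \<open>N\<close> on. Copies at all positions of a sparse finite set \<open>P\<close> still define an open set,
  which therefore contains a point attracted to \<open>W\<close>; its limit points inherit all the constraints.\<close>

lemma limit_point_avoiding_sparse_positions:
  fixes f :: "'a::finite config \<Rightarrow> 'a config"
  assumes f: "cellular_automaton f" and W: "generic_attractor f W" and U: "openin full_shift U"
    and avoid: "\<And>x n. x \<in> cylinder m v \<Longrightarrow> n \<ge> N \<Longrightarrow> (f ^^ n) x \<notin> U"
    and "finite P"
    and sparse: "\<And>p q. p \<in> P \<Longrightarrow> q \<in> P \<Longrightarrow> p \<noteq> q \<Longrightarrow> \<bar>p - q\<bar> > 2 * int m"
  shows "\<exists>z\<in>W. \<forall>p\<in>P. translate p z \<notin> U"
proof -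
  define G where "G = {x. \<forall>p\<in>P. translate p x \<in> cylinder m v}"
  have "openin full_shift (UNIV \<inter> (\<Inter>p\<in>P. translate p -` cylinder m v))"
    using \<open>finite P\<close>
    by (intro openin_Int_Inter)
       (auto intro: openin_translate_vimage openin_cylinder openin_full_shift_UNIV)
  moreover have "UNIV \<inter> (\<Inter>p\<in>P. translate p -` cylinder m v) = G"
    by (auto simp: G_def)
  ultimately have "openin full_shift G" by simp
  moreover have "G \<noteq> {}"
    using cylinder_copies_at_sparse_positions[OF sparse] by (auto simp: G_def)
  ultimately obtain x where x: "x \<in> G" "omega_limit f x \<subseteq> W"
    using comeager_meets_open[of "attraction_domain f W" G] W
    by (auto simp: generic_attractor_def attraction_domain_def)
  obtain z where z: "z \<in> omega_limit f x"
    using omega_limit_meets[OF closedin_full_shift_UNIV, of f x] by blast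
  have "translate p z \<notin> U" if p: "p \<in> P" for p
  proof
    assume "translate p z \<in> U"
    then obtain n where "n \<ge> N" "(f ^^ n) x \<in> translate p -` U"
      using omega_limit_visits[OF z openin_translate_vimage[OF U]] by blast
    then have "(f ^^ n) (translate p x) \<in> U"
      by (simp add: cellular_automaton_funpow_translate[OF f])
    moreover have "translate p x \<in> cylinder m v"
      using x(1) p by (simp add: G_def)
    ultimately show False using avoid \<open>n \<ge> N\<close> by blast
  qed
  then show ?thesis using z x(2) by blast
qed

lemma block_positions_sparse:
  fixes p :: "nat \<Rightarrow> int"
  assumes p: "\<And>i. i < s \<Longrightarrow> p i \<in> {int (i * c)..<int (i * c) + int M}"
    and "i < s" "j < s" "p i + int (s * c) * k \<noteq> p j + int (s * c) * l" and c: "c = 2 * m + M"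
  shows "\<bar>(p i + int (s * c) * k) - (p j + int (s * c) * l)\<bar> > 2 * int m"
proof -
  \<comment> \<open>The position \<open>p i + s * c * k\<close> lies in the initial part, of length \<open>M\<close>, of block number
    \<open>i + s * k\<close> of length \<open>c\<close>; distinct positions lie in distinct blocks.\<close>
  have bounds: "int c * (int i + int s * k) \<le> p i + int (s * c) * k"
      "p i + int (s * c) * k < int c * (int i + int s * k) + int M"
    if "i < s" for i k
    using p[OF that] by (auto simp: algebra_simps)
  have gap: "q - q' > 2 * int m"
    if "b' < b" "int c * b \<le> q" "q' < int c * b' + int M" for b b' q q' :: int
  proof -
    have "int c * (b' + 1) \<le> int c * b"
      using that(1) by (intro mult_left_mono) auto
    then show ?thesis using that(2,3) c by (simp add: algebra_simps)
  qed
  have "int i + int s * k \<noteq> int j + int s * l"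
  proof
    assume eq: "int i + int s * k = int j + int s * l"
    then have "(int i + int s * k) mod int s = (int j + int s * l) mod int s" by simp
    then have "i = j" using assms(2,3) by simp
    then have "k = l" using eq assms(2) by simp
    then show False using \<open>i = j\<close> assms(4) by simp
  qed
  then consider "int i + int s * k < int j + int s * l" | "int j + int s * l < int i + int s * k"
    by linarith
  then show ?thesis
  proof cases
    case 1
    from gap[OF this bounds(1)[OF assms(3)] bounds(2)[OF assms(2)]] show ?thesis by linarith
  next
    case 2
    from gap[OF this bounds(1)[OF assms(2)] bounds(2)[OF assms(3)]] show ?thesis by linarith
  qed
qed

text \<open>The combinatorial core: a periodic set of positions, with gaps as large as desired, is built so
  that every translate of it meets the visits of one point \<open>y \<in> W\<close> to \<open>U\<close>. That is an open condition
  on \<open>y\<close> and so recurs with bounded gaps in every other point of \<open>W\<close>; the unknown return time is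
  absorbed by the period.\<close>

lemma shift_minimal_unavoidable_positions:
  fixes W :: "'a::finite config set"
  assumes W: "shift_minimal W" and U: "openin full_shift U" "W \<inter> U \<noteq> {}"
  obtains P where "finite P"
    "\<And>p q. p \<in> P \<Longrightarrow> q \<in> P \<Longrightarrow> p \<noteq> q \<Longrightarrow> \<bar>p - q\<bar> > 2 * int m"
    "\<And>z. z \<in> W \<Longrightarrow> \<exists>p\<in>P. translate p z \<in> U"
proof -
  have "subshift W" using W by (simp add: shift_minimal_def)
  obtain y where y: "y \<in> W" using U(2) by blast
  obtain L where L: "\<And>z. z \<in> W \<Longrightarrow> \<exists>j. \<bar>j\<bar> \<le> int L \<and> translate j z \<in> U"
    using shift_minimal_returns[OF W U] by blast
  define M where "M = 2 * L + 1"
  define c where "c = 2 * m + M"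
  define Q where "Q = {j. translate j y \<in> U}"
  have syndetic: "\<exists>j\<in>{a..<a + int M}. j \<in> Q" for a
  proof -
    have "translate (a + int L) y \<in> W"
      by (intro translate_subshift[OF \<open>subshift W\<close>] y)
    then obtain j where j: "\<bar>j\<bar> \<le> int L" "translate j (translate (a + int L) y) \<in> U"
      using L by blast
    then have "j + (a + int L) \<in> Q" by (simp add: Q_def)
    moreover have "j + (a + int L) \<in> {a..<a + int M}"
      using j(1) by (auto simp: M_def)
    ultimately show ?thesis by blast
  qed
  have "c > 0" by (simp add: c_def M_def)
  then obtain s p where s: "s > 0"
    and p: "\<And>i. i < s \<Longrightarrow> p i \<in> {int (i * c)..<int (i * c) + int M}"
    and cover: "\<And>t. 0 \<le> t \<Longrightarrow> t < int (s * c) \<Longrightarrow> \<exists>i<s. p i + t \<in> Q"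
    using periodic_positions_meeting_syndetic[of c M Q] syndetic by metis
  define r where "r = int (s * c)"
  have r: "r > 0" using s \<open>c > 0\<close> by (simp add: r_def)
  define V where "V = UNIV \<inter> (\<Inter>t\<in>{0..<r}. \<Union>i\<in>{..<s}. translate (p i + t) -` U)"
  have "openin full_shift V"
    unfolding V_def
  proof (rule openin_Int_Inter)
    show "openin full_shift UNIV" by (rule openin_full_shift_UNIV)
    show "finite ((\<lambda>t. \<Union>i\<in>{..<s}. translate (p i + t) -` U) ` {0..<r})" by simp
    show "openin full_shift X" if "X \<in> (\<lambda>t. \<Union>i\<in>{..<s}. translate (p i + t) -` U) ` {0..<r}" for X
      using that by (auto intro!: openin_clauses(3) openin_translate_vimage U(1))
  qed
  moreover have "y \<in> V"
    using cover by (force simp: V_def Q_def r_def)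
  then have "W \<inter> V \<noteq> {}" using y by blast
  ultimately obtain K where K: "\<And>z. z \<in> W \<Longrightarrow> \<exists>j. \<bar>j\<bar> \<le> int K \<and> translate j z \<in> V"
    using shift_minimal_returns[OF W, of V] by blast
  define P where "P = (\<lambda>(i, l). p i + r * l) ` ({..<s} \<times> {- (int K + r)..int K + r})"
  show ?thesis
  proof (rule that)
    show "finite P" by (simp add: P_def)
    show "\<bar>q - q'\<bar> > 2 * int m" if q: "q \<in> P" "q' \<in> P" "q \<noteq> q'" for q q'
    proof -
      obtain i l where il: "i < s" "q = p i + int (s * c) * l"
        using q(1) by (auto simp: P_def r_def)
      obtain i' l' where il': "i' < s" "q' = p i' + int (s * c) * l'"
        using q(2) by (auto simp: P_def r_def)
      have "p i + int (s * c) * l \<noteq> p i' + int (s * c) * l'"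
        using q(3) unfolding il(2) il'(2) .
      with p il(1) il'(1) show ?thesis
        unfolding il(2) il'(2) by (rule block_positions_sparse) (simp_all add: c_def)
    qed
    show "\<exists>q\<in>P. translate q z \<in> U" if z: "z \<in> W" for z
    proof -
      obtain j where j: "\<bar>j\<bar> \<le> int K" "translate j z \<in> V" using K z by blast
      \<comment> \<open>Complete the return time \<open>j\<close> to a multiple of the period.\<close>
      define t where "t = (- j) mod r"
      have t: "0 \<le> t" "t < r" using r by (simp_all add: t_def)
      have "\<exists>i<s. translate (p i + t) (translate j z) \<in> U"
        using j(2) t unfolding V_def by (auto simp del: translate_translate)
      then obtain i where i: "i < s" "translate (p i + t) (translate j z) \<in> U" by blast
      define l where "l = - ((- j) div r)"
      have l: "t + j = r * l"
        unfolding t_def l_def mult_minus_right using mult_div_mod_eq[of r "- j"] by linarith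
      have "1 * \<bar>l\<bar> \<le> r * \<bar>l\<bar>" using r by (intro mult_right_mono) auto
      also have "\<dots> = \<bar>t + j\<bar>" using r by (simp add: l abs_mult)
      finally have "\<bar>l\<bar> \<le> int K + r" using j(1) t by linarith
      then have "(i, l) \<in> {..<s} \<times> {- (int K + r)..int K + r}"
        using i(1) by (simp add: abs_le_iff)
      then have "p i + r * l \<in> P"
        unfolding P_def by (rule rev_image_eqI) simp
      moreover have "translate (p i + r * l) z \<in> U"
        using i(2) unfolding translate_translate l[symmetric] add.assoc .
      ultimately show ?thesis by blast
    qed
  qed
qed

theorem proposition4p7:
  fixes f :: "(int \<Rightarrow> 'a::finite) \<Rightarrow> (int \<Rightarrow> 'a)"
  assumes "cellular_automaton f"
    and "shift_minimal (generic_limit_set f)"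
  shows "inclusion_minimal f (generic_limit_set f)"
  unfolding inclusion_minimal_def
proof (intro conjI allI impI)
  let ?W = "generic_limit_set f"
  have W: "generic_attractor f ?W"
    by (rule generic_limit_set_generic_attractor)
  have "\<not> meager_in full_shift (attraction_domain f ?W)"
  proof
    assume "meager_in full_shift (attraction_domain f ?W)"
    moreover have "meager_in full_shift (UNIV - attraction_domain f ?W)"
      using W by (simp add: generic_attractor_def comeager_in_def)
    ultimately have "meager_in full_shift (\<Union>{attraction_domain f ?W, UNIV - attraction_domain f ?W})"
      by (intro meager_in_countable_Union) auto
    then have "meager_in full_shift (UNIV :: 'a config set)"
      by simp
    then have "full_shift interior_of (UNIV :: 'a config set) = {}"
      by (rule meager_in_interior_empty[OF compact_full_shift Hausdorff_full_shift])
    then show False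
      using interior_of_openin[OF openin_full_shift_UNIV] by blast
  qed
  then show "attractor f ?W"
    using W by (simp add: attractor_def generic_attractor_def)
  fix B
  assume B: "closedin full_shift B \<and> B \<subset> ?W"
  show "meager_in full_shift (attraction_domain f B)"
  proof (rule ccontr)
    assume nonmeager: "\<not> meager_in full_shift (attraction_domain f B)"
    obtain y where y: "y \<in> ?W" "y \<notin> B" using B by blast
    have "\<forall>x\<in>- B. \<exists>k. cylinder k x \<subseteq> - B"
      using B by (simp add: closedin_full_shift_iff openin_full_shift_iff)
    then obtain k where "cylinder k y \<subseteq> - B" using y(2) by blast
    then have disjoint: "cylinder k y \<inter> B = {}" by blast
    obtain m v N where avoid: "\<And>x n. x \<in> cylinder m v \<Longrightarrow> n \<ge> N \<Longrightarrow> (f ^^ n) x \<notin> cylinder k y"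
      by (rule nonmeager_domain_avoiding_cylinder[OF assms(1) nonmeager openin_cylinder
            closedin_cylinder disjoint]) (erule that)
    have "?W \<inter> cylinder k y \<noteq> {}" using y(1) self_in_cylinder by blast
    then obtain P where P: "finite P"
      "\<And>p q. p \<in> P \<Longrightarrow> q \<in> P \<Longrightarrow> p \<noteq> q \<Longrightarrow> \<bar>p - q\<bar> > 2 * int m"
      "\<And>z. z \<in> ?W \<Longrightarrow> \<exists>p\<in>P. translate p z \<in> cylinder k y"
      by (rule shift_minimal_unavoidable_positions[OF assms(2) openin_cylinder]) (rule that)
    have "\<exists>z\<in>?W. \<forall>p\<in>P. translate p z \<notin> cylinder k y"
      using assms(1) W openin_cylinder avoid P(1,2) by (rule limit_point_avoiding_sparse_positions)
    then obtain z where z: "z \<in> ?W" "\<forall>p\<in>P. translate p z \<notin> cylinder k y" ..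
    from P(3)[OF z(1)] z(2) show False by blast
  qed
qed

end
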